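(* Let $\mathbb A=\mathbb A^3_{1,2,3}$. Let $F=(f_1,f_2,f_3)$ be an $\mathbb A$-algebrizable vector field defined on an open set $\Omega\subset\mathbb R^3$, and $E_i:=e_iF$ (product in $\mathbb A$) for $i=1,2,3$. Then $$E_1=(f_1,0,0),\qquad E_2=(0,f_2,0),\qquad E_3=(0,0,f_3).$$ In addition, $$\int_\gamma\frac eF\,d\xi=\left(\int_\gamma G_1\cdot ds,\int_\gamma G_2\cdot ds,\int_\gamma G_3\cdot ds\right)$$ for every differentiable path $\gamma$ contained in $\Omega(F,\mathbb A^* )$, where $G_1,G_2,G_3$ are the vector fields, conservative on every simply connected open subset of $\Omega(F,\mathbb A^* )$, given by $G_i=\frac1{f_i}e_i$ for $i=1,2,3$. Moreover, $\langle E_i,G_j\rangle=\delta_{ij}$ for $i,j\in\{1,2,3\}$. Thus, a potential function $h_i$ of $G_i$ (on a simply connected open subset of $\Omega(F,\mathbb A^* )$) is a first integral of $E_j$ for $i,j\in\{1,2,3\}$, $i\ne j$.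
   Context: $\mathbb A^3_{1,2,3}$ denotes $\mathbb R^3$ (canonical basis $e_1,e_2,e_3$) with the product $e_ie_i=e_i$ for $i=1,2,3$ and $e_ie_j=0$ for $i\ne j$; its unit is $e=e_1+e_2+e_3$. $\mathbb A^*$ is the set of invertible elements, the inverse of $a$ being $\frac ea$. A vector field $F:\Omega\to\mathbb R^3$ is $\mathbb A$-algebrizable if there is $F':\Omega\to\mathbb R^3$ with $\lim_{\xi\to0}|F(w+\xi)-F(w)-F'(w)\xi|/|\xi|=0$ for all $w\in\Omega$ (product in $\mathbb A$). $\Omega(F,\mathbb A^* )=F^{-1}(\mathbb A^* )$. For a (piecewise continuously) differentiable curve $\gamma:[0,a]\to\Omega(F,\mathbb A^* )$: $\int_\gamma\frac eFd\xi=\int_0^a\frac e{F(\gamma(t))}\dot\gamma(t)\,dt$ (product in $\mathbb A$), $\int_\gamma G\cdot ds=\int_0^a\langle G(\gamma(t)),\dot\gamma(t)\rangle dt$. A potential of $G$ is $h$ with $\nabla h=G$; a first integral of $E$ is a differentiable $h$ with $\langle\nabla h,E\rangle=0$. *)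

theory Defs
  imports "HOL-Analysis.Analysis"
begin

text \<open>
  The algebra is the library ring \<^typ>\<open>real ^ 3\<close> with its componentwise product; the
  canonical basis is \<^term>\<open>axis i (1::real)\<close> for \<open>i :: 3\<close>. The next three lemmas say that
  this product is the bilinear one determined by \<open>e\<^sub>i e\<^sub>i = e\<^sub>i\<close> and \<open>e\<^sub>i e\<^sub>j = 0\<close> (for
  \<open>i \<noteq> j\<close>), with unit \<open>e\<^sub>1 + e\<^sub>2 + e\<^sub>3\<close>.
\<close>

lemma axis_times_axis:
  "axis i 1 * axis j 1 = (if i = j then axis i 1 else (0 :: real ^ 3))"
  by (auto simp: vec_eq_iff axis_def)

lemma bilinear_times_vec: "bilinear ((*) :: real ^ 3 \<Rightarrow> real ^ 3 \<Rightarrow> real ^ 3)"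
  by (auto simp: bilinear_def linear_iff vec_eq_iff algebra_simps)

lemma one_vec_eq_sum_axis: "(1 :: real ^ 3) = axis 1 1 + axis 2 1 + axis 3 1"
  by (simp add: vec_eq_iff axis_def forall_3)

definition alg_units :: "(real ^ 3) set" where
  "alg_units = {a. \<exists>b. a * b = 1}"

text \<open>Only meaningful on \<^const>\<open>alg_units\<close>, where the inverse is unique.\<close>

definition alg_inverse :: "real ^ 3 \<Rightarrow> real ^ 3" where
  "alg_inverse a = (THE b. a * b = 1)"

definition algebrizable_on :: "(real ^ 3 \<Rightarrow> real ^ 3) \<Rightarrow> (real ^ 3) set \<Rightarrow> bool" where
  "algebrizable_on F \<Omega> \<longleftrightarrow>
     (\<exists>F'. \<forall>w\<in>\<Omega>. ((\<lambda>\<xi>. norm (F (w + \<xi>) - F w - F' w * \<xi>) / norm \<xi>) \<longlongrightarrow> 0) (at 0))"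

definition regular_set :: "(real ^ 3 \<Rightarrow> real ^ 3) \<Rightarrow> (real ^ 3) set \<Rightarrow> (real ^ 3) set" where
  "regular_set F \<Omega> = {x \<in> \<Omega>. F x \<in> alg_units}"

text \<open>
  Integrands of \<open>\<integral>\<^sub>\<gamma> (e/F) d\<xi>\<close> and of \<open>\<integral>\<^sub>\<gamma> G \<cdot> ds\<close> for a path \<open>\<gamma>\<close> on \<open>[0,a]\<close>. The derivative
  of \<open>\<gamma>\<close> is one-sided at the endpoints; at the finitely many points where \<open>\<gamma>\<close> may fail to be
  differentiable its value is irrelevant.
\<close>

definition alg_integrand ::
    "(real ^ 3 \<Rightarrow> real ^ 3) \<Rightarrow> real \<Rightarrow> (real \<Rightarrow> real ^ 3) \<Rightarrow> real \<Rightarrow> real ^ 3" where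
  "alg_integrand F a \<gamma> t =
     alg_inverse (F (\<gamma> t)) * vector_derivative \<gamma> (at t within {0..a})"

definition line_integrand ::
    "(real ^ 3 \<Rightarrow> real ^ 3) \<Rightarrow> real \<Rightarrow> (real \<Rightarrow> real ^ 3) \<Rightarrow> real \<Rightarrow> real" where
  "line_integrand G a \<gamma> t = G (\<gamma> t) \<bullet> vector_derivative \<gamma> (at t within {0..a})"

definition alg_integral ::
    "(real ^ 3 \<Rightarrow> real ^ 3) \<Rightarrow> real \<Rightarrow> (real \<Rightarrow> real ^ 3) \<Rightarrow> real ^ 3" where
  "alg_integral F a \<gamma> = integral {0..a} (alg_integrand F a \<gamma>)"

definition line_integral ::
    "(real ^ 3 \<Rightarrow> real ^ 3) \<Rightarrow> real \<Rightarrow> (real \<Rightarrow> real ^ 3) \<Rightarrow> real" where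
  "line_integral G a \<gamma> = integral {0..a} (line_integrand G a \<gamma>)"

definition potential_on ::
    "(real ^ 3 \<Rightarrow> real) \<Rightarrow> (real ^ 3 \<Rightarrow> real ^ 3) \<Rightarrow> (real ^ 3) set \<Rightarrow> bool" where
  "potential_on h G U \<longleftrightarrow> (\<forall>x\<in>U. GDERIV h x :> G x)"

definition conservative_on :: "(real ^ 3 \<Rightarrow> real ^ 3) \<Rightarrow> (real ^ 3) set \<Rightarrow> bool" where
  "conservative_on G U \<longleftrightarrow> (\<exists>h. potential_on h G U)"

definition first_integral_on ::
    "(real ^ 3 \<Rightarrow> real) \<Rightarrow> (real ^ 3 \<Rightarrow> real ^ 3) \<Rightarrow> (real ^ 3) set \<Rightarrow> bool" where
  "first_integral_on h E U \<longleftrightarrow> (\<forall>x\<in>U. \<exists>D. (GDERIV h x :> D) \<and> D \<bullet> E x = 0)"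

definition E_field :: "(real ^ 3 \<Rightarrow> real ^ 3) \<Rightarrow> 3 \<Rightarrow> real ^ 3 \<Rightarrow> real ^ 3" where
  "E_field F i x = axis i 1 * F x"

definition G_field :: "(real ^ 3 \<Rightarrow> real ^ 3) \<Rightarrow> 3 \<Rightarrow> real ^ 3 \<Rightarrow> real ^ 3" where
  "G_field F i x = (1 / (F x $ i)) *\<^sub>R axis i 1"

end

theory Submission
  imports Defs
begin

text \<open>
  The derivative of an algebrizable \<open>F\<close> at \<open>w\<close> is the product with \<open>F' w\<close>, a diagonal
  linear map. Hence \<open>f\<^sub>i\<close> has vanishing derivative in every direction orthogonal to
  \<open>e\<^sub>i\<close>, and on each ball inside \<open>\<Omega>\<close> it is a function of the coordinate \<open>x\<^sub>i\<close>
  alone. If it does not vanish there, an antiderivative \<open>g\<close> of \<open>1/f\<^sub>i\<close> in that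
  single variable gives the local potential \<open>y \<mapsto> g (y\<^sub>i)\<close> of
  \<open>G\<^sub>i\<close> (lemma \<open>G_field_locally_conservative\<close>). Two claims need the passage from
  these local potentials to global objects.

  Conservativity: a locally conservative field on a simply connected open set has a
  potential (\<open>conservative_on_simply_connected\<close>). The components \<open>f\<^sub>i\<close> are merely
  differentiable and the deforming homotopies merely continuous, so Green's theorem does not
  apply. Instead one follows a local potential along a continuous map \<open>H\<close>: a function
  \<open>k\<close> on the domain of \<open>H\<close> that locally equals \<open>h \<circ> H\<close> up to a constant, for
  every local potential \<open>h\<close>, is called a primitive along \<open>H\<close>. On connected domains it
  is unique up to a constant, and on boxes it exists by subdivision and gluing. Applied to the
  unit square, this shows that the increment of a primitive along a path depends only on the
  homotopy class of the path, and that increment from a base point is the potential.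

  Integrability: the derivative of a path that is only piecewise differentiable may be
  unbounded, and the product of a continuous function with a gauge integrable one need not be
  integrable, so continuity of \<open>G\<^sub>i\<close> is not enough. But a primitive along \<open>\<gamma>\<close> is
  continuous and has derivative \<open>\<langle>G\<^sub>i(\<gamma>(t)), \<gamma>'(t)\<rangle>\<close> off a finite set, and the fundamental
  theorem of calculus for the gauge integral applies (\<open>line_integrand_integrable\<close>).

  The rest is computation in coordinates: products and inverses in the algebra are
  componentwise, so the components of the algebra integral are the three line integrals, and
  \<open>\<langle>E\<^sub>i, G\<^sub>j\<rangle> = \<delta>\<^sub>i\<^sub>j\<close> says in particular that the gradient \<open>G\<^sub>i\<close> of
  \<open>h\<^sub>i\<close> is orthogonal to \<open>E\<^sub>j\<close> for \<open>i \<noteq> j\<close>.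
\<close>

section \<open>Local potentials\<close>

definition locally_conservative_on :: "(real ^ 3 \<Rightarrow> real ^ 3) \<Rightarrow> (real ^ 3) set \<Rightarrow> bool" where
  "locally_conservative_on G U \<longleftrightarrow> (\<forall>x\<in>U. \<exists>e>0. conservative_on G (ball x e))"

lemma locally_conservative_on_subset:
  "locally_conservative_on G U \<Longrightarrow> V \<subseteq> U \<Longrightarrow> locally_conservative_on G V"
  by (auto simp: locally_conservative_on_def)

lemma potential_on_subset: "potential_on h G V \<Longrightarrow> U \<subseteq> V \<Longrightarrow> potential_on h G U"
  by (auto simp: potential_on_def)

lemma potentials_differ_by_constant:
  assumes "convex V" "potential_on h G V" "potential_on h' G V" "x \<in> V" "y \<in> V"
  shows "h x - h' x = h y - h' y"
proof -
  have "((\<lambda>x. h x - h' x) has_derivative (\<lambda>_. 0)) (at z within V)" if "z \<in> V" for z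
  proof -
    have "GDERIV (\<lambda>x. h x - h' x) z :> G z - G z"
      using assms(2,3) that unfolding potential_on_def by (intro GDERIV_diff) auto
    then show ?thesis by (simp add: gderiv_def has_derivative_at_withinI)
  qed
  then show ?thesis
    using has_derivative_zero_constant[OF \<open>convex V\<close>, of "\<lambda>x. h x - h' x"] assms(4,5) by metis
qed

lemma eventually_in_ball:
  assumes "continuous_on S H" "t \<in> S" "0 < e"
  shows "\<forall>\<^sub>F s in nhds t. s \<in> S \<longrightarrow> H s \<in> ball (H t) e"
proof -
  obtain T where "open T" "t \<in> T" "\<forall>s\<in>S. s \<in> T \<longrightarrow> H s \<in> ball (H t) e"
    using assms unfolding continuous_on_topological by (meson centre_in_ball open_ball)
  then show ?thesis unfolding eventually_nhds by blast
qed

section \<open>Following a local potential along a continuous map\<close>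

text \<open>
  The condition ranges over all local potentials at \<open>H t\<close> instead of asking for one: two
  primitives can then be compared through a common potential, which makes uniqueness and gluing
  immediate. It is informative only where \<open>G\<close> is locally conservative.
\<close>

definition primitive_along ::
    "(real ^ 3 \<Rightarrow> real ^ 3) \<Rightarrow> ('a::topological_space \<Rightarrow> real ^ 3) \<Rightarrow> 'a set \<Rightarrow> ('a \<Rightarrow> real) \<Rightarrow> bool" where
  "primitive_along G H S k \<longleftrightarrow>
     (\<forall>t\<in>S. \<forall>h e. 0 < e \<and> potential_on h G (ball (H t) e) \<longrightarrow>
        (\<forall>\<^sub>F s in nhds t. s \<in> S \<longrightarrow> k s - k t = h (H s) - h (H t)))"

lemma primitive_alongD:
  assumes "primitive_along G H S k" "t \<in> S" "0 < e" "potential_on h G (ball (H t) e)"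
  shows "\<forall>\<^sub>F s in nhds t. s \<in> S \<longrightarrow> k s - k t = h (H s) - h (H t)"
  using assms unfolding primitive_along_def by blast

text \<open>
  Both \<open>k\<close> and \<open>k'\<close> vary like the same local potential near each point, so
  \<open>k - k'\<close> is locally constant.
\<close>

lemma primitive_along_unique:
  assumes "connected S" "locally_conservative_on G (H ` S)"
    and k: "primitive_along G H S k" and k': "primitive_along G H S k'"
    and "s \<in> S" "t \<in> S"
  shows "k s - k' s = k t - k' t"
proof -
  have "(\<lambda>s. k s - k' s) constant_on S"
  proof (rule locally_constant_imp_constant[OF \<open>connected S\<close>])
    fix t assume t: "t \<in> S"
    obtain h e where h: "0 < e" "potential_on h G (ball (H t) e)"
      using assms(2) t unfolding locally_conservative_on_def conservative_on_def by blast
    have "\<forall>\<^sub>F s in nhds t. s \<in> S \<longrightarrow> k s - k' s = k t - k' t"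
      using primitive_alongD[OF k, OF t h] primitive_alongD[OF k', OF t h] by eventually_elim auto
    then obtain T where "open T" "t \<in> T" "\<forall>s\<in>T. s \<in> S \<longrightarrow> k s - k' s = k t - k' t"
      unfolding eventually_nhds by blast
    then show "\<exists>T. openin (top_of_set S) T \<and> t \<in> T \<and> (\<forall>s\<in>T. k s - k' s = k t - k' t)"
      using t openin_open_Int[of T S] by blast
  qed
  then show ?thesis using \<open>s \<in> S\<close> \<open>t \<in> S\<close> by (auto simp: constant_on_def)
qed

lemma primitive_along_subset:
  assumes "primitive_along G H S k" "T \<subseteq> S" shows "primitive_along G H T k"
  unfolding primitive_along_def
proof (intro ballI allI impI, elim conjE)
  fix t h e assume t: "t \<in> T" and h: "0 < e" "potential_on h G (ball (H t) e)"
  have "\<forall>\<^sub>F s in nhds t. s \<in> S \<longrightarrow> k s - k t = h (H s) - h (H t)"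
    by (rule primitive_alongD[OF assms(1), OF subsetD[OF assms(2) t] h])
  then show "\<forall>\<^sub>F s in nhds t. s \<in> T \<longrightarrow> k s - k t = h (H s) - h (H t)"
    by eventually_elim (use assms(2) in blast)
qed

lemma primitive_along_cong:
  assumes "primitive_along G H S k" "\<And>s. s \<in> S \<Longrightarrow> H s = H' s"
  shows "primitive_along G H' S k"
  unfolding primitive_along_def
proof (intro ballI allI impI, elim conjE)
  fix t h e assume t: "t \<in> S" and "0 < e" "potential_on h G (ball (H' t) e)"
  then have "0 < e" "potential_on h G (ball (H t) e)" using assms(2)[OF t] by simp_all
  from primitive_alongD[OF assms(1), OF t this]
  have "\<forall>\<^sub>F s in nhds t. s \<in> S \<longrightarrow> k s - k t = h (H s) - h (H t)" .
  then show "\<forall>\<^sub>F s in nhds t. s \<in> S \<longrightarrow> k s - k t = h (H' s) - h (H' t)"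
    by eventually_elim (use assms(2) t in auto)
qed

lemma primitive_along_add_const:
  assumes "primitive_along G H S k" shows "primitive_along G H S (\<lambda>s. k s + c)"
  using assms by (simp add: primitive_along_def)

lemma primitive_along_compose:
  assumes "primitive_along G H S k" "continuous_on T \<phi>" "\<phi> ` T \<subseteq> S"
  shows "primitive_along G (\<lambda>t. H (\<phi> t)) T (\<lambda>t. k (\<phi> t))"
  unfolding primitive_along_def
proof (intro ballI allI impI, elim conjE)
  fix t h e assume t: "t \<in> T" and h: "0 < e" "potential_on h G (ball (H (\<phi> t)) e)"
  have "\<phi> t \<in> S" using t assms(3) by blast
  from primitive_alongD[OF assms(1), OF this h] obtain B where
    B: "open B" "\<phi> t \<in> B" "\<forall>s\<in>B. s \<in> S \<longrightarrow> k s - k (\<phi> t) = h (H s) - h (H (\<phi> t))"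
    unfolding eventually_nhds by blast
  obtain A where A: "open A" "t \<in> A" "\<forall>s\<in>T. s \<in> A \<longrightarrow> \<phi> s \<in> B"
    using assms(2)[unfolded continuous_on_topological, rule_format, OF t B(1,2)] by blast
  show "\<forall>\<^sub>F s in nhds t. s \<in> T \<longrightarrow> k (\<phi> s) - k (\<phi> t) = h (H (\<phi> s)) - h (H (\<phi> t))"
    unfolding eventually_nhds
    using A B(3) assms(3) by (intro exI[of _ A]) blast
qed

text \<open>
  The given potential has to be compared with every local potential at \<open>H t\<close>, on a ball
  small enough to lie in both of their domains.
\<close>

lemma primitive_along_potential:
  assumes "potential_on h G V" "open V" "continuous_on S H" "H ` S \<subseteq> V"
  shows "primitive_along G H S (\<lambda>s. h (H s))"
  unfolding primitive_along_def
proof (intro ballI allI impI, elim conjE)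
  fix t h' e' assume t: "t \<in> S" and h': "0 < e'" "potential_on h' G (ball (H t) e')"
  have "H t \<in> V" using t assms(4) by blast
  then obtain e where "0 < e" "ball (H t) e \<subseteq> V"
    using \<open>open V\<close> open_contains_ball by blast
  define d where "d = min e e'"
  have d: "0 < d" "ball (H t) d \<subseteq> V" "ball (H t) d \<subseteq> ball (H t) e'"
    using h' \<open>0 < e\<close> \<open>ball (H t) e \<subseteq> V\<close> by (auto simp: d_def)
  have *: "h x - h' x = h (H t) - h' (H t)" if "x \<in> ball (H t) d" for x
    using d that potential_on_subset[OF assms(1) d(2)] potential_on_subset[OF h'(2) d(3)]
    by (intro potentials_differ_by_constant[where V = "ball (H t) d"]) auto
  show "\<forall>\<^sub>F s in nhds t. s \<in> S \<longrightarrow> h (H s) - h (H t) = h' (H s) - h' (H t)"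
    using eventually_in_ball[OF assms(3) t d(1)] by eventually_elim (use * in force)
qed

text \<open>
  On the connected overlap the two primitives differ by a constant; shifting one of them by it
  makes them agree there. Closedness of the two pieces makes the glued function a primitive also
  at points of just one piece, since such a point has a neighbourhood that avoids the other.
\<close>

lemma primitive_along_glue:
  assumes "closed A" "closed B" "connected (A \<inter> B)" "A \<inter> B \<noteq> {}"
    and "locally_conservative_on G (H ` (A \<inter> B))"
    and kA: "primitive_along G H A kA" and kB: "primitive_along G H B kB"
  shows "\<exists>k. primitive_along G H (A \<union> B) k"
proof -
  obtain z where z: "z \<in> A \<inter> B" using assms(4) by blast
  define k where "k = (\<lambda>s. if s \<in> A then kA s else kB s + (kA z - kB z))"
  have k_A: "k s = kA s" if "s \<in> A" for s using that by (simp add: k_def)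
  have k_B: "k s = kB s + (kA z - kB z)" if "s \<in> B" for s
  proof (cases "s \<in> A")
    case True
    then have "kA s - kB s = kA z - kB z"
      using that z primitive_along_subset[OF kA] primitive_along_subset[OF kB]
      by (intro primitive_along_unique[OF assms(3,5)]) auto
    then show ?thesis by (simp add: k_A[OF True])
  qed (simp add: k_def)
  have near: "\<forall>\<^sub>F s in nhds t. s \<in> C \<longrightarrow> k s - k t = h (H s) - h (H t)"
    if "closed C" "primitive_along G H C k" "0 < e" "potential_on h G (ball (H t) e)"
    for C t h e
  proof (cases "t \<in> C")
    case False
    then have "\<forall>\<^sub>F s in nhds t. s \<in> - C"
      using \<open>closed C\<close> by (intro eventually_nhds_in_open) auto
    then show ?thesis by eventually_elim simp
  qed (use primitive_alongD[OF that(2), OF _ that(3,4)] in blast)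
  have kA': "primitive_along G H A k"
    using kA unfolding primitive_along_def by (simp add: k_A cong: imp_cong)
  have kB': "primitive_along G H B k"
    using kB unfolding primitive_along_def by (simp add: k_B cong: imp_cong)
  have "primitive_along G H (A \<union> B) k"
    unfolding primitive_along_def
  proof (intro ballI allI impI, elim conjE)
    fix t h e assume h: "0 < e" "potential_on h G (ball (H t) e)"
    show "\<forall>\<^sub>F s in nhds t. s \<in> A \<union> B \<longrightarrow> k s - k t = h (H s) - h (H t)"
      using near[OF assms(1) kA' h] near[OF assms(2) kB' h] by eventually_elim blast
  qed
  then show ?thesis by blast
qed

section \<open>Primitives on boxes\<close>

text \<open>
  The part of the open box outside \<open>B\<close> is an open subset of the thin piece, hence empty;
  the closed box is the closure of the open one.
\<close>

lemma cbox_subset_closed_if_rest_thin: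
  assumes "box a b \<noteq> {}" "closed B" "A \<union> B = UNIV" "interior (cbox a b \<inter> A) = {}"
  shows "cbox a b \<subseteq> B"
proof -
  have "box a b - B \<subseteq> interior (cbox a b \<inter> A)"
  proof (rule interior_maximal)
    show "box a b - B \<subseteq> cbox a b \<inter> A" using assms(3) box_subset_cbox[of a b] by blast
    show "open (box a b - B)" using assms(2) by (intro open_Diff open_box)
  qed
  then have "box a b \<subseteq> B" using assms(4) by blast
  from closure_minimal[OF this assms(2)] show ?thesis
    using closure_box[OF assms(1)] by simp
qed

text \<open>
  The step of the subdivision argument. A piece with empty interior carries no
  information; in that case the cut lies outside the open box or on its boundary, and the other
  piece is the whole box.
\<close>

lemma primitive_along_halves:
  fixes H :: "'a::euclidean_space \<Rightarrow> real ^ 3"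
  assumes "locally_conservative_on G (H ` cbox a b)" "box a b \<noteq> {}"
    and L: "interior (cbox a b \<inter> {x. x \<bullet> i \<le> c}) = {} \<or>
      (\<exists>k. primitive_along G H (cbox a b \<inter> {x. x \<bullet> i \<le> c}) k)"
    and R: "interior (cbox a b \<inter> {x. x \<bullet> i \<ge> c}) = {} \<or>
      (\<exists>k. primitive_along G H (cbox a b \<inter> {x. x \<bullet> i \<ge> c}) k)"
  shows "\<exists>k. primitive_along G H (cbox a b) k"
proof -
  define A where "A = {x. x \<bullet> i \<le> c}"
  define B where "B = {x. x \<bullet> i \<ge> c}"
  have sets: "closed A" "closed B" "convex A" "convex B" "A \<union> B = UNIV"
    using closed_halfspace_le[of i c] closed_halfspace_ge[of c i]
      convex_halfspace_le[of i c] convex_halfspace_ge[of c i]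
    by (auto simp: A_def B_def inner_commute[of _ i])
  have int: "interior (cbox a b) \<noteq> {}" using assms(2) by simp
  note L = L[folded A_def] and R = R[folded B_def]
  consider "cbox a b \<subseteq> A" | "cbox a b \<subseteq> B"
    | "interior (cbox a b \<inter> A) \<noteq> {}" "interior (cbox a b \<inter> B) \<noteq> {}"
    using cbox_subset_closed_if_rest_thin[OF assms(2)] sets by (metis Un_commute)
  then show ?thesis
  proof cases
    case 1
    then show ?thesis using L int by (simp add: Int_absorb2)
  next
    case 2
    then show ?thesis using R int by (simp add: Int_absorb2)
  next
    case 3
    then obtain kL kR
      where k: "primitive_along G H (cbox a b \<inter> A) kL" "primitive_along G H (cbox a b \<inter> B) kR"
      using L R by blast
    obtain x y where "x \<in> cbox a b \<inter> A" "y \<in> cbox a b \<inter> B" using 3 interior_subset by blast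
    then have "\<exists>z\<in>cbox a b. i \<bullet> z = c"
      by (intro connected_ivt_hyperplane[of _ x y])
        (auto simp: A_def B_def inner_commute[of _ i] convex_connected)
    then have ne: "(cbox a b \<inter> A) \<inter> (cbox a b \<inter> B) \<noteq> {}"
      by (auto simp: A_def B_def inner_commute[of _ i])
    have con: "connected ((cbox a b \<inter> A) \<inter> (cbox a b \<inter> B))"
      by (intro convex_connected convex_Int sets convex_box)
    have lc: "locally_conservative_on G (H ` ((cbox a b \<inter> A) \<inter> (cbox a b \<inter> B)))"
      by (rule locally_conservative_on_subset[OF assms(1)]) blast
    have "\<exists>k. primitive_along G H ((cbox a b \<inter> A) \<union> (cbox a b \<inter> B)) k"
      by (rule primitive_along_glue[OF _ _ con ne lc k]) (intro closed_Int closed_cbox sets)+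
    moreover have "(cbox a b \<inter> A) \<union> (cbox a b \<inter> B) = cbox a b" using sets(5) by blast
    ultimately show ?thesis by simp
  qed
qed

text \<open>
  Existence of a primitive passes from the two halves of a cut box to the box and
  back, so it suffices to have it on the boxes of a sufficiently fine division. By continuity
  \<open>H\<close> maps each of these into a ball on which \<open>G\<close> has a potential.
\<close>

lemma primitive_along_box_exists:
  fixes H :: "'a::euclidean_space \<Rightarrow> real ^ 3"
  assumes cont: "continuous_on (cbox a b) H" and lc: "locally_conservative_on G (H ` cbox a b)"
    and ne: "box a b \<noteq> {}"
  shows "\<exists>k. primitive_along G H (cbox a b) k"
proof -
  \<comment> \<open>Intersecting with the given box keeps the property meaningful on all boxes, as an additive
    interval function requires, although \<open>G\<close> is locally conservative only on the image of
    this one. Pieces with empty interior count as good.\<close>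
  define P where "P S \<longleftrightarrow> interior (cbox a b \<inter> S) = {} \<or> (\<exists>k. primitive_along G H (cbox a b \<inter> S) k)" for S
  interpret operative conj True P
  proof
    show "P (cbox c d) = True" if "box c d = {}" for c d
      using that by (simp add: P_def)
    fix c d :: 'a and m i
    let ?L = "cbox c d \<inter> {x. x \<bullet> i \<le> m}" and ?R = "cbox c d \<inter> {x. x \<bullet> i \<ge> m}"
    obtain u v where uv: "cbox a b \<inter> cbox c d = cbox u v" using Int_interval by blast
    have LR: "cbox a b \<inter> ?L = cbox u v \<inter> {x. x \<bullet> i \<le> m}"
      "cbox a b \<inter> ?R = cbox u v \<inter> {x. x \<bullet> i \<ge> m}"
      using uv by blast+
    have lc': "locally_conservative_on G (H ` cbox u v)"
      by (rule locally_conservative_on_subset[OF lc]) (use uv in blast)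
    have "P ?L" "P ?R" if "P (cbox c d)"
      using that primitive_along_subset[of G H "cbox u v"] interior_mono[of _ "cbox u v"]
      unfolding P_def LR uv by blast+
    moreover have "P (cbox c d)" if "P ?L" "P ?R"
    proof (cases "box u v = {}")
      case False
      then show ?thesis
        using primitive_along_halves[OF lc' False] that unfolding P_def LR uv by blast
    qed (simp add: P_def uv)
    ultimately show "P (cbox c d) \<longleftrightarrow> P ?L \<and> P ?R" by blast
  qed
  define R where "R t = (SOME e. 0 < e \<and> conservative_on G (ball (H t) e))" for t
  have R: "0 < R t" "conservative_on G (ball (H t) (R t))" if "t \<in> cbox a b" for t
    using someI_ex[of "\<lambda>e. 0 < e \<and> conservative_on G (ball (H t) e)"] lc that
    unfolding R_def locally_conservative_on_def by blast+
  have "\<exists>d>0. \<forall>s \<in> cbox a b \<inter> ball t d. H s \<in> ball (H t) (R t)" if "t \<in> cbox a b" for t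
    using cont[unfolded continuous_on_iff, rule_format, OF that R(1)[OF that]]
    by (auto simp: dist_commute)
  then obtain d where d: "\<And>t. t \<in> cbox a b \<Longrightarrow> 0 < d t"
    "\<And>t s. t \<in> cbox a b \<Longrightarrow> s \<in> cbox a b \<inter> ball t (d t) \<Longrightarrow> H s \<in> ball (H t) (R t)"
    by metis
  define d' where "d' t = (if t \<in> cbox a b then d t else 1)" for t
  have "gauge (\<lambda>t. ball t (d' t))"
    by (rule gauge_ball_dependent) (auto simp: d'_def d)
  then obtain p where p: "p tagged_division_of cbox a b" "(\<lambda>t. ball t (d' t)) fine p"
    using fine_division_exists by blast
  have "P K" if "(t, K) \<in> p" for t K
  proof -
    have K: "t \<in> cbox a b" "K \<subseteq> cbox a b"
      using tagged_division_ofD(2,3)[OF p(1) that] by blast+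
    have "K \<subseteq> ball t (d t)" using fineD[OF p(2) that] K(1) by (simp add: d'_def)
    then have HK: "H ` K \<subseteq> ball (H t) (R t)" using d(2)[OF K(1)] K(2) by blast
    obtain h where h: "potential_on h G (ball (H t) (R t))"
      using R(2)[OF K(1)] unfolding conservative_on_def by blast
    have "primitive_along G H K (\<lambda>s. h (H s))"
      by (rule primitive_along_potential[OF h open_ball continuous_on_subset[OF cont K(2)] HK])
    moreover have "cbox a b \<inter> K = K" using K(2) by blast
    ultimately show ?thesis by (auto simp: P_def)
  qed
  then have "P (cbox a b)"
    unfolding division[OF division_of_tagged_division[OF p(1)], symmetric] comm_monoid_set_F_and
    by auto
  then show ?thesis using ne by (simp add: P_def)
qed

lemma primitive_along_interval_exists:
  fixes H :: "real \<Rightarrow> real ^ 3"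
  assumes "continuous_on {a..b} H" "locally_conservative_on G (H ` {a..b})" "a < b"
  shows "\<exists>k. primitive_along G H {a..b} k"
  using primitive_along_box_exists[of a b H G] assms by (simp add: box_real)

section \<open>Potentials on simply connected sets\<close>

text \<open>
  A primitive on the square along the homotopy restricts to primitives along \<open>p\<close> and
  \<open>q\<close> on two opposite edges. On the other two edges the homotopy is constant, since it
  fixes the endpoints, so the primitive takes the same value at both ends of each of them.
\<close>

lemma primitive_along_homotopy:
  fixes p q :: "real \<Rightarrow> real ^ 3"
  assumes lc: "locally_conservative_on G U" and hom: "homotopic_paths U p q"
    and kp: "primitive_along G p {0..1} kp" and kq: "primitive_along G q {0..1} kq"
  shows "kp 1 - kp 0 = kq 1 - kq 0"
proof -
  obtain H where H: "continuous_on ({0..1} \<times> {0..1}) H" "H ` ({0..1} \<times> {0..1}) \<subseteq> U"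
    and H01: "\<forall>x\<in>{0..1}. H (0, x) = p x" "\<forall>x\<in>{0..1}. H (1, x) = q x"
    and Hlr: "\<forall>s\<in>{0..1::real}. pathstart (H \<circ> Pair s) = pathstart p \<and>
      pathfinish (H \<circ> Pair s) = pathfinish p"
    using hom unfolding homotopic_paths image_subset_iff_funcset by blast
  note H0 = bspec[OF H01(1)] and H1 = bspec[OF H01(2)]
  have Hl: "H (s, 0) = p 0" and Hr: "H (s, 1) = p 1" if "s \<in> {0..1}" for s
    using bspec[OF Hlr that] by (simp_all add: pathstart_def pathfinish_def)
  have sq: "{0..1::real} \<times> {0..1::real} = cbox (0, 0) (1, 1)"
    by (simp add: cbox_Pair_eq)
  have "(1/2, 1/2) \<in> box (0, 0) (1::real, 1::real)"
    by (auto simp: mem_box Basis_prod_def)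
  then have "\<exists>k. primitive_along G H ({0..1} \<times> {0..1}) k"
    using H locally_conservative_on_subset[OF lc] unfolding sq
    by (intro primitive_along_box_exists) auto
  then obtain k where k: "primitive_along G H ({0..1} \<times> {0..1}) k" by blast
  have img: "locally_conservative_on G (H ` V)" if "V \<subseteq> {0..1} \<times> {0..1}" for V
    using H(2) that by (intro locally_conservative_on_subset[OF lc]) blast
  have edge: "k (\<phi> 1) - k' 1 = k (\<phi> 0) - k' 0"
    if "continuous_on {0..1} \<phi>" "\<phi> ` {0..1} \<subseteq> {0..1} \<times> {0..1}"
      "\<And>x. x \<in> {0..1::real} \<Longrightarrow> r x = H (\<phi> x)" "primitive_along G r {0..1} k'" for r \<phi> k'
  proof (rule primitive_along_unique)
    show "primitive_along G (\<lambda>x. H (\<phi> x)) {0..1} (\<lambda>x. k (\<phi> x))"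
      by (rule primitive_along_compose[OF k that(1,2)])
    show "primitive_along G (\<lambda>x. H (\<phi> x)) {0..1} k'"
      by (rule primitive_along_cong[OF that(4) that(3)])
    show "locally_conservative_on G ((\<lambda>x. H (\<phi> x)) ` {0..1})"
      using img[OF that(2)] by (simp add: image_image)
  qed auto
  have const: "primitive_along G (\<lambda>_. x) {0..1::real} (\<lambda>_. 0)" for x
    by (simp add: primitive_along_def)
  have "k (0, 1) - kp 1 = k (0, 0) - kp 0"
    by (rule edge[where r = p]) (auto simp: H0 kp intro!: continuous_intros)
  moreover have "k (1, 1) - kq 1 = k (1, 0) - kq 0"
    by (rule edge[where r = q]) (auto simp: H1 kq intro!: continuous_intros)
  moreover have "k (1, 0) - 0 = k (0, 0) - 0"
    by (rule edge[OF _ _ _ const[of "p 0"]]) (auto simp: Hl intro!: continuous_intros)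
  moreover have "k (1, 1) - 0 = k (0, 1) - 0"
    by (rule edge[OF _ _ _ const[of "p 1"]]) (auto simp: Hr intro!: continuous_intros)
  ultimately show ?thesis by simp
qed

text \<open>
  The potential at \<open>x\<close> is the increment of a primitive along any path from a base point to
  \<open>x\<close>; simple connectedness makes it independent of the path. Extending a path by a short
  segment shows that it differs from a local potential near \<open>x\<close> by a constant.
\<close>

theorem conservative_on_simply_connected:
  assumes "open U" "simply_connected U" and lc: "locally_conservative_on G U"
  shows "conservative_on G U"
proof (cases "U = {}")
  case True
  then show ?thesis by (simp add: conservative_on_def potential_on_def)
next
  case False
  then obtain x0 where x0: "x0 \<in> U" by blast
  have pc: "path_connected U" using assms(2) by (rule simply_connected_imp_path_connected)
  have hom: "homotopic_paths U p q"
    if "path p" "path_image p \<subseteq> U" "path q" "path_image q \<subseteq> U"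
      "pathstart q = pathstart p" "pathfinish q = pathfinish p" for p q
    using assms(2) that unfolding simply_connected_eq_homotopic_paths by blast
  have prim: "\<exists>k. primitive_along G p {0..1} k" if "path p" "path_image p \<subseteq> U" for p
    using that locally_conservative_on_subset[OF lc]
    by (intro primitive_along_interval_exists) (auto simp: path_def path_image_def)
  define reach where "reach x p k \<longleftrightarrow> path p \<and> path_image p \<subseteq> U \<and> pathstart p = x0 \<and>
    pathfinish p = x \<and> primitive_along G p {0..1} k" for x p k
  have ex: "\<exists>p k. reach x p k" if "x \<in> U" for x
    using pc x0 that prim unfolding path_connected_def reach_def by metis
  define h where "h x = (SOME c. \<exists>p k. reach x p k \<and> c = k 1 - k 0)" for x
  have h: "h x = k 1 - k 0" if "reach x p k" for x p k
  proof -
    have "\<exists>q l. reach x q l \<and> h x = l 1 - l 0"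
      unfolding h_def by (rule someI_ex) (use that in blast)
    then obtain q l where "reach x q l" "h x = l 1 - l 0" by blast
    then show ?thesis
      using primitive_along_homotopy[OF lc hom] that unfolding reach_def by metis
  qed
  have "GDERIV h x :> G x" if x: "x \<in> U" for x
  proof -
    obtain e where e: "0 < e" "conservative_on G (ball x e)"
      using lc x unfolding locally_conservative_on_def by blast
    obtain e' where e': "0 < e'" "ball x e' \<subseteq> U" using \<open>open U\<close> x open_contains_ball by blast
    obtain g where "potential_on g G (ball x e)" using e(2) unfolding conservative_on_def by blast
    define d where "d = min e e'"
    have d: "0 < d" "ball x d \<subseteq> U" and g: "potential_on g G (ball x d)"
      using e e' \<open>potential_on g G (ball x e)\<close> by (auto simp: d_def intro: potential_on_subset)
    have eq: "g y + (h x - g x) = h y" if y: "y \<in> ball x d" for y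
    proof -
      obtain p k where p: "reach x p k" using ex[OF x] by blast
      let ?l = "linepath x y"
      have l: "path_image ?l \<subseteq> ball x d"
        using y d(1) closed_segment_subset[of x "ball x d" y] by auto
      have j: "path (p +++ ?l)" "path_image (p +++ ?l) \<subseteq> U"
        using p l d(2) unfolding reach_def by (auto simp: path_image_join)
      then obtain m where m: "primitive_along G (p +++ ?l) {0..1} m" using prim by blast
      then have "reach y (p +++ ?l) m" using j p by (simp add: reach_def)
      then have hy: "h y = m 1 - m 0" by (rule h)
      have lcj: "locally_conservative_on G (r ` {0..1})" if "path_image r \<subseteq> U" for r
        using locally_conservative_on_subset[OF lc] that by (simp add: path_image_def)
      \<comment> \<open>On the first half of the joined path \<open>m\<close> follows \<open>p\<close>, on the second half the segment.\<close>
      have 1: "m (1 / 2) - k 1 = m 0 - k 0"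
      proof -
        have "primitive_along G (\<lambda>t. (p +++ ?l) (t / 2)) {0..1} (\<lambda>t. m (t / 2))"
          by (rule primitive_along_compose[OF m]) (auto intro!: continuous_intros)
        then have "primitive_along G p {0..1} (\<lambda>t. m (t / 2))"
          by (rule primitive_along_cong) (auto simp: joinpaths_def)
        from primitive_along_unique[OF _ lcj this, of k 1 0] p
        show ?thesis by (simp add: reach_def)
      qed
      have 2: "m 1 - g y = m (1 / 2) - g x"
      proof -
        have "primitive_along G (\<lambda>t. (p +++ ?l) ((t + 1) / 2)) {0..1} (\<lambda>t. m ((t + 1) / 2))"
          by (rule primitive_along_compose[OF m]) (auto intro!: continuous_intros)
        then have m': "primitive_along G ?l {0..1} (\<lambda>t. m ((t + 1) / 2))"
        proof (rule primitive_along_cong)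
          fix t :: real assume "t \<in> {0..1}"
          moreover have "2 * ((t + 1) / 2) - 1 = t" by (simp add: field_simps)
          ultimately show "(p +++ ?l) ((t + 1) / 2) = ?l t"
            using p unfolding joinpaths_def reach_def pathfinish_def
            by (cases "t = 0") (auto simp: linepath_0')
        qed
        have "primitive_along G ?l {0..1} (\<lambda>t. g (?l t))"
          using l by (intro primitive_along_potential[OF g]) (auto simp: path_image_def continuous_on_linepath)
        from primitive_along_unique[OF _ lcj m' this, of 1 0] l d(2)
        show ?thesis by (simp add: linepath_def)
      qed
      show ?thesis using 1 2 hy h[OF p] by simp
    qed
    have "GDERIV (\<lambda>y. g y + (h x - g x)) x :> G x"
      using GDERIV_add[of g x "G x" _ 0, OF _ GDERIV_const] g d(1) by (simp add: potential_on_def)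
    then show ?thesis
      unfolding gderiv_def
      by (rule has_derivative_transform_within_open[OF _ open_ball _ eq]) (use d(1) in simp_all)
  qed
  then show ?thesis unfolding conservative_on_def potential_on_def by blast
qed

section \<open>Line integrals along piecewise differentiable paths\<close>

text \<open>
  The integral is the increment of a primitive \<open>k\<close> along \<open>\<gamma>\<close>. The fundamental theorem
  of calculus for the gauge integral asks only for continuity of \<open>k\<close> and for its derivative
  off a finite set; no bound on the speed of \<open>\<gamma>\<close> is available.
\<close>

theorem line_integrand_integrable:
  assumes "0 \<le> a" "\<gamma> piecewise_differentiable_on {0..a}"
    and lc: "locally_conservative_on G (\<gamma> ` {0..a})"
  shows "line_integrand G a \<gamma> integrable_on {0..a}"
proof (cases "a = 0")
  case True
  then show ?thesis using has_integral_refl(2)[of "line_integrand G a \<gamma>" 0] by (auto simp: integrable_on_def)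
next
  case False
  with assms(1) have a: "0 < a" by simp
  obtain N where cont: "continuous_on {0..a} \<gamma>" and N: "finite N"
    "\<And>t. t \<in> {0..a} - N \<Longrightarrow> \<gamma> differentiable at t within {0..a}"
    using assms(2) unfolding piecewise_differentiable_on_def by blast
  obtain k where k: "primitive_along G \<gamma> {0..a} k"
    using primitive_along_interval_exists[OF cont lc a] by blast
  have loc: "\<exists>h. GDERIV h (\<gamma> t) :> G (\<gamma> t) \<and>
      (\<forall>\<^sub>F s in at t within {0..a}. k s = h (\<gamma> s)) \<and> k t = h (\<gamma> t)" if t: "t \<in> {0..a}" for t
  proof -
    obtain e h where e: "0 < e" and h: "potential_on h G (ball (\<gamma> t) e)"
      using lc t unfolding locally_conservative_on_def conservative_on_def by blast
    \<comment> \<open>Shifting the local potential turns equality of increments into equality of values.\<close>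
    let ?h = "\<lambda>x. h x + (k t - h (\<gamma> t))"
    have "\<forall>\<^sub>F s in at t within {0..a}. k s = ?h (\<gamma> s)"
      using primitive_alongD[OF k, OF t e h] unfolding eventually_at_filter
      by eventually_elim auto
    moreover have "GDERIV h (\<gamma> t) :> G (\<gamma> t)" using h e by (simp add: potential_on_def)
    then have "GDERIV ?h (\<gamma> t) :> G (\<gamma> t)"
      using GDERIV_add[of h "\<gamma> t" "G (\<gamma> t)" _ 0, OF _ GDERIV_const] by simp
    ultimately show ?thesis by (intro exI[of _ ?h]) auto
  qed
  have "(line_integrand G a \<gamma> has_integral (k a - k 0)) {0..a}"
  proof (rule fundamental_theorem_of_calculus_interior_strong[OF N(1) assms(1)])
    show "continuous_on {0..a} k"
      unfolding continuous_on_def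
    proof
      fix t assume t: "t \<in> {0..a}"
      from loc[OF t] obtain h where h: "GDERIV h (\<gamma> t) :> G (\<gamma> t)"
        and ev: "\<forall>\<^sub>F s in at t within {0..a}. k s = h (\<gamma> s)" and kt: "k t = h (\<gamma> t)" by blast
      have "isCont h (\<gamma> t)" using h has_derivative_continuous unfolding gderiv_def by blast
      moreover have "(\<gamma> \<longlongrightarrow> \<gamma> t) (at t within {0..a})"
        using cont t by (simp add: continuous_on_def)
      ultimately have "((\<lambda>s. h (\<gamma> s)) \<longlongrightarrow> k t) (at t within {0..a})"
        unfolding kt by (rule isCont_tendsto_compose)
      then show "(k \<longlongrightarrow> k t) (at t within {0..a})"
        using ev by (subst tendsto_cong)
    qed
  next
    fix t assume t: "t \<in> {0<..<a} - N"
    from loc[of t] t obtain h where h: "GDERIV h (\<gamma> t) :> G (\<gamma> t)"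
      and ev: "\<forall>\<^sub>F s in at t within {0..a}. k s = h (\<gamma> s)" and kt: "k t = h (\<gamma> t)" by auto
    define v where "v = vector_derivative \<gamma> (at t within {0..a})"
    have within: "at t within {0..a} = at t" using t by (intro at_within_interior) auto
    have "(\<gamma> has_vector_derivative v) (at t within {0..a})"
      using N(2)[of t] t vector_derivative_works unfolding v_def by auto
    then have "(\<gamma> has_derivative (\<lambda>r. r *\<^sub>R v)) (at t)"
      by (simp add: within has_vector_derivative_def)
    from has_derivative_compose[OF this h[unfolded gderiv_def]]
    have "((\<lambda>s. h (\<gamma> s)) has_derivative (\<lambda>r. (r *\<^sub>R v) \<bullet> G (\<gamma> t))) (at t)" .
    then have "((\<lambda>s. h (\<gamma> s)) has_vector_derivative line_integrand G a \<gamma> t) (at t)"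
      by (simp add: has_vector_derivative_def line_integrand_def v_def inner_commute)
    then show "(k has_vector_derivative line_integrand G a \<gamma> t) (at t)"
      unfolding has_vector_derivative_def
      by (rule has_derivative_transform_eventually) (use ev kt in \<open>auto simp: within elim: eventually_mono\<close>)
  qed
  then show ?thesis by (rule has_integral_integrable)
qed

section \<open>Algebrizable fields\<close>

lemma algebrizable_has_derivative:
  assumes "algebrizable_on F \<Omega>"
  obtains F' where "\<And>w. w \<in> \<Omega> \<Longrightarrow> (F has_derivative (\<lambda>\<xi>. F' w * \<xi>)) (at w)"
proof -
  obtain F' where F': "\<And>w. w \<in> \<Omega> \<Longrightarrow>
      ((\<lambda>\<xi>. norm (F (w + \<xi>) - F w - F' w * \<xi>) / norm \<xi>) \<longlongrightarrow> 0) (at 0)"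
    using assms unfolding algebrizable_on_def by blast
  have "bounded_linear (\<lambda>\<xi>. c * \<xi>)" for c :: "real ^ 3"
    using bilinear_times_vec unfolding bilinear_def by (simp add: linear_conv_bounded_linear)
  then show ?thesis using F' that by (auto simp: has_derivative_at)
qed

text \<open>
  Along a segment orthogonal to \<open>e\<^sub>i\<close> the \<open>i\<close>-th component of the derivative
  \<open>F' w * \<xi>\<close> is \<open>F' w $ i * 0\<close>.
\<close>

lemma algebrizable_component_local:
  assumes "algebrizable_on F \<Omega>" and "convex V" "V \<subseteq> \<Omega>" "y \<in> V" "z \<in> V" "y $ i = z $ i"
  shows "F y $ i = F z $ i"
proof -
  obtain F' where F': "\<And>w. w \<in> \<Omega> \<Longrightarrow> (F has_derivative (\<lambda>\<xi>. F' w * \<xi>)) (at w)"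
    using algebrizable_has_derivative[OF assms(1)] by blast
  have "((\<lambda>s. F (linepath y z s) $ i) has_derivative (\<lambda>_. 0)) (at s within {0..1})"
    if "s \<in> {0..1}" for s
  proof -
    have "linepath y z s \<in> V"
      using assms(2,4,5) that closed_segment_subset linepath_in_path by blast
    then have "linepath y z s \<in> \<Omega>" using assms(3) by blast
    moreover have "(linepath y z has_derivative (\<lambda>r. r *\<^sub>R (z - y))) (at s within {0..1})"
      using has_vector_derivative_linepath_within[of y z s "{0..1}"]
      by (simp add: has_vector_derivative_def)
    ultimately have "((\<lambda>s. F (linepath y z s)) has_derivative
        (\<lambda>r. F' (linepath y z s) * (r *\<^sub>R (z - y)))) (at s within {0..1})"
      using has_derivative_compose F' by blast
    then have "((\<lambda>s. F (linepath y z s) $ i) has_derivative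
        (\<lambda>r. (F' (linepath y z s) * (r *\<^sub>R (z - y))) $ i)) (at s within {0..1})"
      by (rule bounded_linear.has_derivative[OF bounded_linear_vec_nth])
    then show ?thesis using assms(6) by simp
  qed
  then obtain c where "\<forall>s\<in>{0..1}. F (linepath y z s) $ i = c"
    using has_derivative_zero_constant[of "{0..1}" "\<lambda>s. F (linepath y z s) $ i"] by auto
  then have "F (linepath y z 0) $ i = F (linepath y z 1) $ i" by simp
  then show ?thesis by (simp add: linepath_0' linepath_1')
qed

lemma alg_unitsD: 
  assumes "a \<in> alg_units" shows "a $ i \<noteq> 0"
proof
  assume 0: "a $ i = 0"
  obtain b where "a * b = 1" using assms unfolding alg_units_def by blast
  then have "a $ i * b $ i = 1" by (metis one_index vector_mult_component)
  then show False using 0 by simp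
qed

lemma alg_inverse_nth:
  assumes "a \<in> alg_units" shows "alg_inverse a $ i = 1 / a $ i"
proof -
  have inv: "a * b = 1 \<longleftrightarrow> b = (\<chi> i. 1 / a $ i)" for b
    using alg_unitsD[OF assms] by (auto simp: vec_eq_iff field_simps)
  then have "alg_inverse a = (\<chi> i. 1 / a $ i)" unfolding alg_inverse_def by simp
  then show ?thesis by simp
qed

text \<open>
  Near \<open>x\<close> the field \<open>G\<^sub>i\<close> depends on the \<open>i\<close>-th coordinate alone, so its
  potential is a one-variable antiderivative of \<open>1/f\<^sub>i\<close>, read off on the line through
  \<open>x\<close> in direction \<open>e\<^sub>i\<close>.
\<close>

lemma G_field_locally_conservative:
  assumes "open \<Omega>" and alg: "algebrizable_on F \<Omega>"
  shows "locally_conservative_on (G_field F i) (regular_set F \<Omega>)"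
  unfolding locally_conservative_on_def
proof
  fix x assume x: "x \<in> regular_set F \<Omega>"
  obtain F' where F': "\<And>w. w \<in> \<Omega> \<Longrightarrow> (F has_derivative (\<lambda>\<xi>. F' w * \<xi>)) (at w)"
    using algebrizable_has_derivative[OF alg] by blast
  have Fc: "isCont (\<lambda>w. F w $ i) w" if "w \<in> \<Omega>" for w
    using has_derivative_continuous[OF F'[OF that]] by (intro continuous_intros) auto
  have x\<Omega>: "x \<in> \<Omega>" and Fx: "F x $ i \<noteq> 0" using x alg_unitsD by (auto simp: regular_set_def)
  obtain e0 where e0: "0 < e0" "ball x e0 \<subseteq> \<Omega>" using assms(1) x\<Omega> open_contains_ball by blast
  have "\<forall>\<^sub>F w in at x. F w $ i \<noteq> 0"
    using tendsto_imp_eventually_ne[of _ "F x $ i" "at x" 0] Fc[OF x\<Omega>] Fx by (simp add: isCont_def)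
  then obtain e1 where e1: "0 < e1" "\<And>w. dist w x < e1 \<Longrightarrow> F w $ i \<noteq> 0"
    using Fx unfolding eventually_at by (metis UNIV_I)
  \<comment> \<open>Half the radius leaves room for the closed interval \<open>?J\<close> on which the antiderivative is
    taken: the corresponding segment stays inside the larger ball.\<close>
  define e where "e = min e0 e1 / 2"
  have e: "0 < e" "ball x (2 * e) \<subseteq> \<Omega>" "\<And>w. w \<in> ball x (2 * e) \<Longrightarrow> F w $ i \<noteq> 0"
    using e0 e1 by (auto simp: e_def dist_commute)
  \<comment> \<open>The line through \<open>x\<close> in direction \<open>e\<^sub>i\<close>, parametrized by the \<open>i\<close>-th coordinate.\<close>
  define P where "P s = x + (s - x $ i) *\<^sub>R axis i 1" for s
  have P_nth: "P s $ i = s" for s by (simp add: P_def)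
  have P_ball: "P s \<in> ball x (2 * e)" if "\<bar>s - x $ i\<bar> < 2 * e" for s
    using that by (simp add: P_def dist_norm)
  let ?J = "{x $ i - e..x $ i + e}"
  have J: "\<bar>s - x $ i\<bar> < 2 * e" if "s \<in> ?J" for s using that e(1) by auto
  have "continuous_on ?J (\<lambda>s. 1 / F (P s) $ i)"
  proof (rule continuous_at_imp_continuous_on, rule ballI)
    fix s assume "s \<in> ?J"
    then have Ps: "P s \<in> ball x (2 * e)" using J P_ball by blast
    have "isCont P s" unfolding P_def by (intro continuous_intros)
    moreover have "isCont (\<lambda>w. F w $ i) (P s)" using Ps e(2) by (intro Fc) blast
    ultimately have "isCont (\<lambda>s. F (P s) $ i) s" by (rule isCont_o2)
    then show "isCont (\<lambda>s. 1 / F (P s) $ i) s" using e(3)[OF Ps] by (intro continuous_divide continuous_const) auto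
  qed
  then obtain g where g: "\<And>s. s \<in> ?J \<Longrightarrow>
      (g has_vector_derivative 1 / F (P s) $ i) (at s within ?J)"
    using antiderivative_continuous by blast
  have "GDERIV (\<lambda>y. g (y $ i)) y :> G_field F i y" if y: "y \<in> ball x e" for y
  proof -
    have yi: "\<bar>y $ i - x $ i\<bar> < e"
      using component_le_norm_cart[of "y - x" i] y by (simp add: dist_norm norm_minus_commute)
    have "(g has_vector_derivative 1 / F (P (y $ i)) $ i) (at (y $ i) within ?J)"
      by (rule g) (use yi in \<open>auto simp: abs_less_iff\<close>)
    moreover have "at (y $ i) within ?J = at (y $ i)"
      using yi by (intro at_within_interior) (auto simp: abs_less_iff)
    moreover have "F (P (y $ i)) $ i = F y $ i"
      using yi y e(1) P_ball
      by (intro algebrizable_component_local[OF alg convex_ball e(2)]) (auto simp: P_nth)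
    ultimately have "DERIV g (y $ i) :> 1 / F y $ i"
      by (simp add: has_real_derivative_iff_has_vector_derivative)
    moreover have "GDERIV (\<lambda>y. y $ i) y :> axis i 1"
      unfolding gderiv_def inner_axis
      by (simp add: bounded_linear_imp_has_derivative bounded_linear_vec_nth)
    ultimately show ?thesis unfolding G_field_def by (intro GDERIV_DERIV_compose)
  qed
  then show "\<exists>e>0. conservative_on (G_field F i) (ball x e)"
    using e(1) unfolding conservative_on_def potential_on_def by blast
qed

section \<open>Integrals and orthogonality in coordinates\<close>

lemma alg_integrand_nth:
  assumes "F (\<gamma> t) \<in> alg_units"
  shows "alg_integrand F a \<gamma> t $ i = line_integrand (G_field F i) a \<gamma> t"
  by (simp add: alg_integrand_def line_integrand_def G_field_def alg_inverse_nth[OF assms]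
      inner_axis' )

lemma alg_integral_componentwise:
  assumes "\<gamma> ` {0..a} \<subseteq> regular_set F \<Omega>"
    and int: "\<And>i. line_integrand (G_field F i) a \<gamma> integrable_on {0..a}"
  shows "alg_integrand F a \<gamma> integrable_on {0..a}"
    and "alg_integral F a \<gamma> $ i = line_integral (G_field F i) a \<gamma>"
proof -
  have nth: "alg_integrand F a \<gamma> t $ i = line_integrand (G_field F i) a \<gamma> t" if "t \<in> {0..a}" for t i
    by (rule alg_integrand_nth) (use assms(1) that in \<open>auto simp: regular_set_def image_subset_iff\<close>)
  show *: "alg_integrand F a \<gamma> integrable_on {0..a}"
  proof (rule integrable_componentwise)
    fix b :: "real ^ 3" assume "b \<in> Basis"
    then obtain i where b: "b = axis i 1" by (auto simp: Basis_vec_def)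
    show "(\<lambda>t. alg_integrand F a \<gamma> t \<bullet> b) integrable_on {0..a}"
      using integrable_eq[OF int[of i], of "\<lambda>t. alg_integrand F a \<gamma> t $ i"] nth
      by (simp add: b inner_axis)
  qed
  show "alg_integral F a \<gamma> $ i = line_integral (G_field F i) a \<gamma>"
    unfolding alg_integral_def line_integral_def integral_component_eq_cart[OF *, symmetric]
    by (rule integral_cong) (rule nth)
qed

lemma E_field_inner_G_field:
  assumes "F x $ j \<noteq> 0"
  shows "E_field F i x \<bullet> G_field F j x = (if i = j then 1 else 0)"
  using assms by (simp add: E_field_def G_field_def inner_axis) (simp add: axis_def)

section \<open>The canonical splitting of an algebrizable field\<close>

theorem proposition4p3:
  fixes F :: "real ^ 3 \<Rightarrow> real ^ 3" and \<Omega> :: "(real ^ 3) set"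
  assumes "open \<Omega>" and "algebrizable_on F \<Omega>"
  shows "(\<forall>x\<in>\<Omega>. E_field F 1 x = vector [F x $ 1, 0, 0] \<and>
                E_field F 2 x = vector [0, F x $ 2, 0] \<and>
                E_field F 3 x = vector [0, 0, F x $ 3]) \<and>
         (\<forall>a \<gamma>. 0 \<le> a \<and> \<gamma> piecewise_differentiable_on {0..a} \<and>
                \<gamma> ` {0..a} \<subseteq> regular_set F \<Omega> \<longrightarrow>
            alg_integrand F a \<gamma> integrable_on {0..a} \<and>
            (\<forall>i. line_integrand (G_field F i) a \<gamma> integrable_on {0..a}) \<and>
            alg_integral F a \<gamma> =
              vector [line_integral (G_field F 1) a \<gamma>,
                      line_integral (G_field F 2) a \<gamma>,
                      line_integral (G_field F 3) a \<gamma>]) \<and>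
         (\<forall>i U. open U \<and> simply_connected U \<and> U \<subseteq> regular_set F \<Omega> \<longrightarrow>
            conservative_on (G_field F i) U) \<and>
         (\<forall>x\<in>regular_set F \<Omega>. \<forall>i j.
            E_field F i x \<bullet> G_field F j x = (if i = j then 1 else 0)) \<and>
         (\<forall>i j U h. i \<noteq> j \<and> open U \<and> simply_connected U \<and> U \<subseteq> regular_set F \<Omega> \<and>
            potential_on h (G_field F i) U \<longrightarrow> first_integral_on h (E_field F j) U)"
proof (intro conjI)
  note lc = G_field_locally_conservative[OF assms]
  show "\<forall>x\<in>\<Omega>. E_field F 1 x = vector [F x $ 1, 0, 0] \<and>
                E_field F 2 x = vector [0, F x $ 2, 0] \<and>
                E_field F 3 x = vector [0, 0, F x $ 3]"
    by (simp add: E_field_def vec_eq_iff forall_3 axis_def)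
  show "\<forall>a \<gamma>. 0 \<le> a \<and> \<gamma> piecewise_differentiable_on {0..a} \<and>
                \<gamma> ` {0..a} \<subseteq> regular_set F \<Omega> \<longrightarrow>
            alg_integrand F a \<gamma> integrable_on {0..a} \<and>
            (\<forall>i. line_integrand (G_field F i) a \<gamma> integrable_on {0..a}) \<and>
            alg_integral F a \<gamma> =
              vector [line_integral (G_field F 1) a \<gamma>,
                      line_integral (G_field F 2) a \<gamma>,
                      line_integral (G_field F 3) a \<gamma>]"
  proof (intro allI impI, elim conjE)
    fix a :: real and \<gamma>
    assume a: "0 \<le> a" "\<gamma> piecewise_differentiable_on {0..a}" and img: "\<gamma> ` {0..a} \<subseteq> regular_set F \<Omega>"
    have int: "line_integrand (G_field F i) a \<gamma> integrable_on {0..a}" for i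
      by (rule line_integrand_integrable[OF a locally_conservative_on_subset[OF lc img]])
    then show "alg_integrand F a \<gamma> integrable_on {0..a} \<and>
            (\<forall>i. line_integrand (G_field F i) a \<gamma> integrable_on {0..a}) \<and>
            alg_integral F a \<gamma> =
              vector [line_integral (G_field F 1) a \<gamma>,
                      line_integral (G_field F 2) a \<gamma>,
                      line_integral (G_field F 3) a \<gamma>]"
      using alg_integral_componentwise[OF img int] by (simp add: vec_eq_iff forall_3)
  qed
  show "\<forall>i U. open U \<and> simply_connected U \<and> U \<subseteq> regular_set F \<Omega> \<longrightarrow>
            conservative_on (G_field F i) U"
    using conservative_on_simply_connected locally_conservative_on_subset[OF lc] by blast
  show dual: "\<forall>x\<in>regular_set F \<Omega>. \<forall>i j.
            E_field F i x \<bullet> G_field F j x = (if i = j then 1 else 0)"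
    using E_field_inner_G_field alg_unitsD by (auto simp: regular_set_def)
  show "\<forall>i j U h. i \<noteq> j \<and> open U \<and> simply_connected U \<and> U \<subseteq> regular_set F \<Omega> \<and>
            potential_on h (G_field F i) U \<longrightarrow> first_integral_on h (E_field F j) U"
  proof (intro allI impI, elim conjE)
    fix i j U h
    assume "i \<noteq> j" "U \<subseteq> regular_set F \<Omega>" and h: "potential_on h (G_field F i) U"
    then have "G_field F i x \<bullet> E_field F j x = 0" if "x \<in> U" for x
      using dual that by (metis inner_commute subsetD)
    then show "first_integral_on h (E_field F j) U"
      using h unfolding first_integral_on_def potential_on_def by blast
  qed
qed

end
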